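(* For integers $m,k\ge 0$, let $P(m,k)$ be the number of partial matchings of $[m]$ with exactly $k$ arcs that contain no $2$-right crossings and no right nestings. Then, as formal power series in $x$ and $y$, $$\sum_{n\geq 1}\sum_{k=0}^{n-1}P(n+k-1,k)\,x^n y^k=\sum_{n\geq 1}\frac{x^n(1+xy)^{\binom{n}{2}}}{\prod_{k=0}^{n-1}\bigl(1-(1+xy)^k xy\bigr)}.$$
   Context: $[m]=\{1,2,\ldots,m\}$, with $[0]=\emptyset$ (which has exactly one partition, the empty one). A partial matching of $[m]$ is a set partition of $[m]$ in which every block has at most two elements; each two-element block $\{i,j\}$ with $i<j$ is called an arc and written $(i,j)$. A right nesting is a pair of arcs $(i_1,j_1)$, $(i_2,j_2)$ with $i_1<i_2<j_2<j_1$ and $j_1=j_2+1$. A $2$-right crossing is a pair of arcs $(i_1,j_1)$, $(i_2,j_2)$ with $i_1<i_2<j_1<j_2$ and $j_2-j_1\le 2$. *)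

theory Defs
  imports
    "HOL-Library.Disjoint_Sets"
    "HOL-Computational_Algebra.Formal_Power_Series"
begin

definition partial_matching :: "nat \<Rightarrow> nat set set \<Rightarrow> bool" where
  "partial_matching m M \<longleftrightarrow> partition_on {1..m} M \<and> (\<forall>B\<in>M. card B \<le> 2)"

definition arcs :: "nat set set \<Rightarrow> (nat \<times> nat) set" where
  "arcs M = {(i, j). i < j \<and> {i, j} \<in> M}"

definition has_right_nesting :: "nat set set \<Rightarrow> bool" where
  "has_right_nesting M \<longleftrightarrow>
     (\<exists>i1 j1 i2 j2. (i1, j1) \<in> arcs M \<and> (i2, j2) \<in> arcs M \<and>
        i1 < i2 \<and> i2 < j2 \<and> j2 < j1 \<and> j1 = j2 + 1)"

definition has_2_right_crossing :: "nat set set \<Rightarrow> bool" where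
  "has_2_right_crossing M \<longleftrightarrow>
     (\<exists>i1 j1 i2 j2. (i1, j1) \<in> arcs M \<and> (i2, j2) \<in> arcs M \<and>
        i1 < i2 \<and> i2 < j1 \<and> j1 < j2 \<and> j2 - j1 \<le> 2)"

definition matching_count :: "nat \<Rightarrow> nat \<Rightarrow> nat" where
  "matching_count m k = card {M. partial_matching m M \<and> card (arcs M) = k \<and>
                    \<not> has_2_right_crossing M \<and> \<not> has_right_nesting M}"

text \<open>
  Power series in \<open>x\<close> and \<open>y\<close> are series in \<open>x\<close> whose coefficients are series in \<open>y\<close> over
  the rationals. The topology of \<^typ>\<open>rat fps fps\<close> is the \<open>x\<close>-adic one; it is finer than
  the \<open>(x, y)\<close>-adic topology, so sums that converge in it also converge, to the same
  value, in the latter.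
\<close>

abbreviation var_x :: "rat fps fps" where "var_x \<equiv> fps_X"

abbreviation var_y :: "rat fps fps" where "var_y \<equiv> fps_const fps_X"

definition lhs_term :: "nat \<Rightarrow> rat fps fps" where
  "lhs_term n = (\<Sum>k=0..n-1. of_nat (matching_count (n + k - 1) k) * var_x ^ n * var_y ^ k)"

definition rhs_term :: "nat \<Rightarrow> rat fps fps" where
  "rhs_term n = var_x ^ n * (1 + var_x * var_y) ^ (n choose 2) /
                (\<Prod>k=0..n-1. 1 - (1 + var_x * var_y) ^ k * (var_x * var_y))"

text \<open>
  \<^typ>\<open>rat fps\<close> is not a field, so the library gives few general facts about division in
  \<^typ>\<open>rat fps fps\<close>. The denominators in \<^const>\<open>rhs_term\<close> have constant coefficient 1,
  and for these the division is the genuine one.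
\<close>

lemma rhs_denominator_nth_0:
  "fps_nth (\<Prod>k=0..n-1. 1 - (1 + var_x * var_y) ^ k * (var_x * var_y)) 0 = 1"
proof -
  have "fps_nth (prod f A) 0 = 1" if "\<And>k. k \<in> A \<Longrightarrow> fps_nth (f k) 0 = 1"
    for f :: "nat \<Rightarrow> rat fps fps" and A
    using that by (induction A rule: infinite_finite_induct) auto
  then show ?thesis by simp
qed

lemma divide_mult_cancel_nth_0:
  fixes f g :: "rat fps fps"
  assumes "fps_nth g 0 = 1"
  shows "f / g * g = f"
proof -
  have s: "subdegree g = 0" using assms by (simp add: subdegree_eq_0_iff)
  have "inverse (fps_nth g 0) = 1"
    by (simp add: assms fps_inverse_one')
  then have "inverse g = fps_right_inverse g 1"
    unfolding fps_inverse_def by simp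
  then have "inverse g * g = 1"
    using fps_right_inverse[of g 1] assms by (simp only: mult.commute) simp
  then show ?thesis
    using s by (simp add: fps_divide_def mult.assoc)
qed

lemma rhs_term_mult_denominator:
  "rhs_term n * (\<Prod>k=0..n-1. 1 - (1 + var_x * var_y) ^ k * (var_x * var_y)) =
     var_x ^ n * (1 + var_x * var_y) ^ (n choose 2)"
  unfolding rhs_term_def by (rule divide_mult_cancel_nth_0[OF rhs_denominator_nth_0])

end

theory Submission
  imports Defs
begin

text \<open>
  A right endpoint immediately after another one always creates a right nesting or a
  \<open>2\<close>-right crossing, so there are no adjacent right endpoints; and right endpoints \<open>j\<close>, \<open>j + 2\<close>
  with left endpoints \<open>a\<close>, \<open>a'\<close> force \<open>a' = j + 1\<close> or \<open>a' < a\<close>. Read a matching from left to right,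
  and let \<open>i\<close> be the number of its unmatched points. A right endpoint following a left endpoint or
  unmatched point \<open>p\<close> either closes \<open>p\<close> itself (a fresh start), or closes an unmatched point
  which, when \<open>p\<close> directly follows a right endpoint, lies below the point that one closed; neither
  move changes \<open>i\<close>. So after each fresh start, and after each point that stays unmatched, one
  chooses a subset of the \<open>i\<close> unmatched points and closes it in decreasing order. With \<open>u = xy\<close>
  marking arcs and \<open>q = 1 + u\<close>, the series \<open>S\<^sub>i\<close> of matchings with \<open>i\<close> unmatched points satisfies
  \<open>S\<^sub>i = q\<^sup>i (S\<^bsub>i-1\<^esub> + u S\<^sub>i)\<close>, with \<open>1\<close> in place of \<open>S\<^bsub>i-1\<^esub>\<close> for \<open>i = 0\<close>.
  Solving this recurrence gives the right-hand side with \<open>n = i + 1\<close>.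
\<close>

section \<open>Arc systems and their unmatched points\<close>

text \<open>Only the arcs of a partial matching are stored; its singletons are the points on no
  arc.\<close>

definition arc_system :: "nat \<Rightarrow> (nat \<times> nat) set \<Rightarrow> bool" where
  "arc_system m A \<longleftrightarrow>
     (\<forall>i j. (i, j) \<in> A \<longrightarrow> 1 \<le> i \<and> i < j \<and> j \<le> m) \<and>
     (\<forall>i j i' j'. (i, j) \<in> A \<and> (i', j') \<in> A \<and> (i = i' \<or> i = j' \<or> j = i' \<or> j = j')
        \<longrightarrow> i = i' \<and> j = j')"

text \<open>The forbidden patterns in terms of right endpoints at distance 1 and 2; see
  \<open>admissible_arcs_iff\<close>.\<close>

definition admissible :: "nat \<Rightarrow> (nat \<times> nat) set \<Rightarrow> bool" where
  "admissible m A \<longleftrightarrow> arc_system m A \<and>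
     (\<forall>i j i'. (i, j) \<in> A \<longrightarrow> (i', Suc j) \<notin> A) \<and>
     (\<forall>i j i'. (i, j) \<in> A \<and> (i', Suc (Suc j)) \<in> A \<longrightarrow> i' < i \<or> i' = Suc j)"

definition free :: "nat \<Rightarrow> (nat \<times> nat) set \<Rightarrow> nat set" where
  "free m A = {a \<in> {1..m}. \<forall>b. (a, b) \<notin> A \<and> (b, a) \<notin> A}"

text \<open>The points that an arc ending at \<open>m + 2\<close> may start from, other than \<open>m + 1\<close>.\<close>

definition avail :: "nat \<Rightarrow> (nat \<times> nat) set \<Rightarrow> nat set" where
  "avail m A = {a \<in> free m A. \<forall>b. (b, m) \<in> A \<longrightarrow> a < b}"

lemma arc_systemD:
  assumes "arc_system m A" "(i, j) \<in> A"
  shows "1 \<le> i" "i < j" "j \<le> m"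
  using assms unfolding arc_system_def by auto

lemma arc_system_unique:
  assumes "arc_system m A" "(i, j) \<in> A" "(i', j') \<in> A" "i = i' \<or> i = j' \<or> j = i' \<or> j = j'"
  shows "i = i'" "j = j'"
  using assms unfolding arc_system_def by blast+

lemma admissibleD:
  assumes "admissible m A"
  shows "arc_system m A"
    and "(i, j) \<in> A \<Longrightarrow> (i', Suc j) \<notin> A"
    and "(i, j) \<in> A \<Longrightarrow> (i', Suc (Suc j)) \<in> A \<Longrightarrow> i' < i \<or> i' = Suc j"
  using assms unfolding admissible_def by blast+

lemma arc_system_finite:
  assumes "arc_system m A"
  shows "finite A"
proof (rule finite_subset)
  show "A \<subseteq> {1..m} \<times> {1..m}" using arc_systemD[OF assms] by force
qed simp

lemma finite_admissible: "finite {A. admissible m A \<and> P A}"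
proof (rule finite_subset)
  show "{A. admissible m A \<and> P A} \<subseteq> Pow ({1..m} \<times> {1..m})"
  proof clarify
    fix A i j assume "admissible m A" "(i, j) \<in> A"
    then show "i \<in> {1..m} \<and> j \<in> {1..m}"
      using arc_systemD[OF admissibleD(1), of m A i j] by simp
  qed
qed simp

lemma finite_free [simp]: "finite (free m A)"
  unfolding free_def by simp

lemma avail_subset_free: "avail m A \<subseteq> free m A"
  unfolding avail_def by blast

lemma finite_avail [simp]: "finite (avail m A)"
  using finite_subset[OF avail_subset_free] by simp

text \<open>Left and right endpoints form disjoint sets, each as large as \<open>A\<close>. Hence
  \<open>i\<close> unmatched points and \<open>k\<close> arcs amount to \<open>i + 2 * k\<close>
  points.\<close>

lemma card_free:
  assumes "arc_system m A"
  shows "card (free m A) + 2 * card A = m"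
proof -
  note fin = arc_system_finite[OF assms]
  note D = arc_systemD[OF assms] and U = arc_system_unique[OF assms]
  have inj1: "inj_on fst A"
    by (rule inj_onI) (metis U(2) prod.collapse)
  have inj2: "inj_on snd A"
    by (rule inj_onI) (metis U(1) prod.collapse)
  have disj: "fst ` A \<inter> snd ` A = {}"
  proof -
    have False if "(x, b) \<in> A" "(c, x) \<in> A" for x b c
      using U(1)[OF that] D(2)[OF that(2)] by simp
    then show ?thesis by fastforce
  qed
  have "1 \<le> i \<and> i \<le> m \<and> 1 \<le> j \<and> j \<le> m" if "(i, j) \<in> A" for i j
    using D[OF that] by simp
  then have sub: "fst ` A \<union> snd ` A \<subseteq> {1..m}" by auto
  have "x \<in> free m A \<longleftrightarrow> x \<in> {1..m} - (fst ` A \<union> snd ` A)" for x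
    unfolding free_def by (auto simp: image_iff)
  then have "free m A = {1..m} - (fst ` A \<union> snd ` A)" by blast
  moreover have "card (fst ` A \<union> snd ` A) = 2 * card A"
    using inj1 inj2 disj fin by (simp add: card_Un_disjoint card_image)
  moreover have "card (fst ` A \<union> snd ` A) \<le> m"
    using card_mono[OF _ sub] by simp
  ultimately show ?thesis
    using sub fin by (simp add: card_Diff_subset)
qed

section \<open>Adding and removing the last arc\<close>

text \<open>Every condition only restricts arcs that are present, so it passes to subsets.\<close>

lemma admissible_subset:
  assumes "admissible m B" "A \<subseteq> B" "\<And>i j. (i, j) \<in> A \<Longrightarrow> j \<le> m'"
  shows "admissible m' A"
  unfolding admissible_def arc_system_def
proof (intro conjI allI impI; (elim conjE)?)
  note s = admissibleD(1)[OF assms(1)]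
  fix i j assume a: "(i, j) \<in> A"
  then have aB: "(i, j) \<in> B" using assms(2) by blast
  show "1 \<le> i" "i < j" "j \<le> m'"
    using arc_systemD[OF s aB] assms(3)[OF a] by auto
  fix i'
  show "(i', Suc j) \<notin> A"
    using admissibleD(2)[OF assms(1) aB, of i'] assms(2) by blast
  show "i' < i \<or> i' = Suc j" if "(i', Suc (Suc j)) \<in> A"
    using admissibleD(3)[OF assms(1) aB, of i'] assms(2) that by blast
  fix j'
  show "i = i'" "j = j'" if "(i', j') \<in> A" "i = i' \<or> i = j' \<or> j = i' \<or> j = j'"
    using arc_system_unique[OF s aB _ that(2)] that(1) assms(2) by auto
qed

lemma admissible_Suc_iff: "admissible (Suc m) A \<and> (\<forall>a. (a, Suc m) \<notin> A) \<longleftrightarrow> admissible m A"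
proof
  assume *: "admissible (Suc m) A \<and> (\<forall>a. (a, Suc m) \<notin> A)"
  then have "j \<le> m" if "(i, j) \<in> A" for i j
    using that arc_systemD(3)[OF admissibleD(1), of "Suc m" A i j] by (metis le_SucE)
  with * show "admissible m A"
    using admissible_subset by blast
next
  assume g: "admissible m A"
  then have le: "j \<le> m" if "(i, j) \<in> A" for i j
    using that arc_systemD(3)[OF admissibleD(1)] by blast
  then have "admissible (Suc m) A" by (intro admissible_subset[OF g]) (auto intro: le_SucI)
  with le show "admissible (Suc m) A \<and> (\<forall>a. (a, Suc m) \<notin> A)" by fastforce
qed

text \<open>No arc of \<open>A\<close> ends at \<open>m + 1\<close>, so a forbidden pattern could
  only involve an arc ending at \<open>m\<close>; both choices of \<open>a\<close> exclude
  it.\<close>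

lemma admissible_insert_last:
  assumes g: "admissible m A" and a: "a \<in> avail m A \<or> a = Suc m"
  shows "admissible (Suc (Suc m)) (insert (a, Suc (Suc m)) A)" (is "admissible ?m ?A")
proof -
  have 1: "1 \<le> i" "i < j" "j \<le> m" "i \<noteq> a" "j \<noteq> a" if "(i, j) \<in> A" for i j
    using arc_systemD[OF admissibleD(1)[OF g] that] that a unfolding avail_def free_def by auto
  have 2: "1 \<le> a" "a < ?m" using a unfolding avail_def free_def by auto
  have 3: "a = Suc m \<or> a < b" if "(b, m) \<in> A" for b
    using that a unfolding avail_def by auto
  show ?thesis
    unfolding admissible_def arc_system_def
  proof (intro conjI allI impI; (elim conjE)?)
    fix i j assume ij: "(i, j) \<in> ?A"
    show "1 \<le> i" "i < j" "j \<le> ?m"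
      using ij 1[of i j] 2 by auto
    fix i'
    show "(i', Suc j) \<notin> ?A"
      using ij 1[of i j] 1[of i' "Suc j"] admissibleD(2)[OF g, of i j i'] by auto
    show "i' < i \<or> i' = Suc j" if "(i', Suc (Suc j)) \<in> ?A"
      using that ij 1[of i j] 1[of i' "Suc (Suc j)"] admissibleD(3)[OF g, of i j i'] 3[of i] by auto
    fix j'
    assume ij': "(i', j') \<in> ?A" and *: "i = i' \<or> i = j' \<or> j = i' \<or> j = j'"
    have "(i, j) = (i', j')"
    proof (cases "(i, j) \<in> A"; cases "(i', j') \<in> A")
      assume "(i, j) \<in> A" "(i', j') \<in> A"
      then show ?thesis using arc_system_unique[OF admissibleD(1)[OF g] _ _ *] by simp
    qed (use ij ij' * 1[of i j] 1[of i' j'] 2 in auto)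
    then show "i = i'" "j = j'" by auto
  qed
qed

text \<open>The fresh start. That the short arc is not in \<open>A\<close> makes the insertion
  proper, so deleting it recovers \<open>A\<close>.\<close>

lemma admissible_short_iff:
  "admissible (Suc (Suc m)) (insert (Suc m, Suc (Suc m)) A) \<and> (Suc m, Suc (Suc m)) \<notin> A \<longleftrightarrow> admissible m A"
  (is "admissible ?m ?A \<and> _ \<longleftrightarrow> _")
proof
  assume g: "admissible ?m ?A \<and> (Suc m, ?m) \<notin> A"
  then have g1: "admissible ?m ?A" and na: "(Suc m, ?m) \<notin> A" by auto
  note D = arc_systemD[OF admissibleD(1)[OF g1]] and U = arc_system_unique[OF admissibleD(1)[OF g1]]
  have "j \<le> m" if "(i, j) \<in> A" for i j
  proof -
    have A: "(i, j) \<in> ?A" "(Suc m, ?m) \<in> ?A" using that by simp_all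
    have "j \<noteq> ?m" using U(1)[OF A] na that by metis
    moreover have "j \<noteq> Suc m" using U(2)[OF A] by auto
    ultimately show ?thesis using D(3)[OF A(1)] by simp
  qed
  then show "admissible m A"
    by (intro admissible_subset[OF g1]) auto
next
  assume g: "admissible m A"
  then show "admissible ?m ?A \<and> (Suc m, ?m) \<notin> A"
    using admissible_insert_last[OF g, of "Suc m"] arc_systemD(3)[OF admissibleD(1)[OF g], of "Suc m" ?m]
    by fastforce
qed

text \<open>A longer last arc. Its right endpoint bars \<open>m + 1\<close> from being one, so
  \<open>A\<close> lives on \<open>m\<close> points; and \<open>a \<le> m\<close> rules out the
  exception \<open>a = m + 1\<close>, leaving \<open>a < b\<close> for an arc
  \<open>(b, m)\<close>.\<close>

lemma admissible_insert_iff: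
  assumes "a \<le> m"
  shows "admissible (Suc (Suc m)) (insert (a, Suc (Suc m)) A) \<and> (a, Suc (Suc m)) \<notin> A
           \<longleftrightarrow> admissible m A \<and> a \<in> avail m A"
  (is "admissible ?m ?A \<and> _ \<longleftrightarrow> _")
proof
  assume g: "admissible ?m ?A \<and> (a, ?m) \<notin> A"
  then have g1: "admissible ?m ?A" and na: "(a, ?m) \<notin> A" by auto
  note D = arc_systemD[OF admissibleD(1)[OF g1]] and U = arc_system_unique[OF admissibleD(1)[OF g1]]
  have le: "j \<le> m" if "(i, j) \<in> A" for i j
  proof -
    have "j \<noteq> ?m" using U(1)[of i j a ?m] na that by auto
    moreover have "j \<noteq> Suc m" using admissibleD(2)[OF g1, of i j a] that by auto
    ultimately show ?thesis using D(3)[of i j] that by simp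
  qed
  then have "admissible m A"
    by (intro admissible_subset[OF g1]) auto
  moreover have "a \<in> free m A"
  proof -
    have "(a, b) \<notin> A" "(b, a) \<notin> A" for b
      using U(2)[of a ?m a b] D(2)[of b a] U(2)[of a ?m b a] le[of a b] assms by auto
    then show ?thesis using D(1)[of a ?m] assms unfolding free_def by auto
  qed
  moreover have "a < b" if "(b, m) \<in> A" for b
    using admissibleD(3)[OF g1, of b m a] that assms by auto
  ultimately show "admissible m A \<and> a \<in> avail m A" unfolding avail_def by blast
next
  assume g: "admissible m A \<and> a \<in> avail m A"
  then show "admissible ?m ?A \<and> (a, ?m) \<notin> A"
    using admissible_insert_last[of m A a] arc_systemD(3)[OF admissibleD(1), of m A a ?m] by auto
qed

text \<open>The bound \<open>a\<close> is stricter than the old one, which \<open>a\<close> met, and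
  the newly unmatched point \<open>m + 1\<close> lies above \<open>a\<close>.\<close>

lemma avail_insert:
  assumes "admissible m A" "a \<in> avail m A"
  shows "avail (Suc (Suc m)) (insert (a, Suc (Suc m)) A) = {x \<in> avail m A. x < a}"
proof -
  have "a \<le> m" using assms(2) unfolding avail_def free_def by simp
  then show ?thesis
    using arc_systemD[OF admissibleD(1)[OF assms(1)]] assms(2) unfolding avail_def free_def
    by fastforce
qed

section \<open>Counting systems by their available points\<close>

text \<open>Ranks index the choices of a left endpoint: by \<open>avail_insert\<close>, the rank of
  \<open>a\<close> is the number of points still available afterwards.\<close>

lemma bij_betw_rank:
  fixes F :: "nat set"
  assumes "finite F"
  shows "bij_betw (\<lambda>a. card {x \<in> F. x < a}) F {..<card F}"
proof -
  have lt: "card {x \<in> F. x < a} < card {x \<in> F. x < b}" if "a \<in> F" "a < b" for a b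
    by (rule psubset_card_mono) (use that assms in auto)
  have inj: "inj_on (\<lambda>a. card {x \<in> F. x < a}) F"
  proof (rule inj_onI)
    fix a b assume "a \<in> F" "b \<in> F" "card {x \<in> F. x < a} = card {x \<in> F. x < b}"
    then show "a = b" using lt[of a b] lt[of b a] by (cases a b rule: linorder_cases) auto
  qed
  moreover have "card {x \<in> F. x < a} < card F" if "a \<in> F" for a
    by (rule psubset_card_mono) (use that assms in auto)
  then have "(\<lambda>a. card {x \<in> F. x < a}) ` F \<subseteq> {..<card F}" by auto
  moreover have "card ((\<lambda>a. card {x \<in> F. x < a}) ` F) = card {..<card F}"
    using card_image[OF inj] by simp
  ultimately show ?thesis
    unfolding bij_betw_def using card_subset_eq[of "{..<card F}"] by simp
qed

text \<open>Here \<open>i\<close> counts unmatched points. With a lower bound \<open>e\<close>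
  instead of an exact count, raising \<open>e\<close> by one splits off one factor
  \<open>1 + xy\<close>. All systems occur for \<open>e = 0\<close>; for \<open>e = i\<close> every
  unmatched point is available.\<close>

definition admissible_sets :: "nat \<Rightarrow> nat \<Rightarrow> nat \<Rightarrow> (nat \<times> nat) set set" where
  "admissible_sets i k e = {A. admissible (i + 2 * k) A \<and> card A = k \<and> e \<le> card (avail (i + 2 * k) A)}"

lemma finite_admissible_sets [simp]: "finite (admissible_sets i k e)"
  unfolding admissible_sets_def by (rule finite_admissible)

lemma card_free_admissible:
  assumes "admissible (i + 2 * k) A" "card A = k"
  shows "card (free (i + 2 * k) A) = i"
  using card_free[OF admissibleD(1)[OF assms(1)]] assms(2) by simp

lemma admissible_last_arc:
  assumes "admissible m A" "(a, m) \<in> A"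
  obtains m' where "m = Suc (Suc m')" "a = Suc m'" "admissible m' (A - {(a, m)})"
  | m' where "m = Suc (Suc m')" "a \<le> m'" "admissible m' (A - {(a, m)})" "a \<in> avail m' (A - {(a, m)})"
proof -
  have "1 \<le> a" "a < m" using arc_systemD[OF admissibleD(1)[OF assms(1)] assms(2)] by auto
  then obtain m' where m: "m = Suc (Suc m')"
    using that by (cases m; cases "m - 1") auto
  let ?B = "A - {(a, m)}"
  have A: "admissible (Suc (Suc m')) (insert (a, Suc (Suc m')) ?B)" "(a, Suc (Suc m')) \<notin> ?B"
    using assms insert_Diff[OF assms(2)] m by simp_all
  show thesis
  proof (cases "a = Suc m'")
    case True
    then have "admissible m' ?B" using A admissible_short_iff[of m' ?B] by blast
    with m True show thesis by (rule that(1))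
  next
    case False
    then have le: "a \<le> m'" using \<open>a < m\<close> m by simp
    then have "admissible m' ?B" "a \<in> avail m' ?B" using A admissible_insert_iff[OF le, of ?B] by blast+
    with m le show thesis by (rule that(2))
  qed
qed

lemma avail_eq_free_iff:
  assumes "admissible m A"
  shows "card (avail m A) = card (free m A) \<longleftrightarrow> (\<forall>a. (a, m) \<in> A \<longrightarrow> Suc a = m)"
proof
  assume c: "card (avail m A) = card (free m A)"
  then have eq: "avail m A = free m A"
    by (rule card_subset_eq[OF finite_free avail_subset_free])
  show "\<forall>a. (a, m) \<in> A \<longrightarrow> Suc a = m"
  proof (intro allI impI)
    fix a assume a: "(a, m) \<in> A"
    note U = arc_system_unique[OF admissibleD(1)[OF assms]]
      and D = arc_systemD[OF admissibleD(1)[OF assms]]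
    show "Suc a = m"
    proof (rule ccontr)
      assume "Suc a \<noteq> m"
      then obtain m' where m: "m = Suc (Suc m')" "a \<le> m'"
        by (cases rule: admissible_last_arc[OF assms a]) auto
      \<comment> \<open>The point \<open>m - 1\<close> is unmatched: an arc from it would share the
        endpoint \<open>m\<close> with \<open>(a, m)\<close>, and an arc ending at it would be
        followed by the right endpoint \<open>m\<close>.\<close>
      have "(Suc m', b) \<notin> A" for b
      proof
        assume b: "(Suc m', b) \<in> A"
        then have "b = m" using D(2,3)[OF b] m(1) by simp
        then show False using U(1)[OF b a] m by simp
      qed
      moreover have "(b, Suc m') \<notin> A" for b
        using admissibleD(2)[OF assms, of b "Suc m'" a] a m by blast
      ultimately have "Suc m' \<in> free m A" using m unfolding free_def by auto
      then have "Suc m' < a" using a eq unfolding avail_def by blast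
      then show False using m by simp
    qed
  qed
next
  assume *: "\<forall>a. (a, m) \<in> A \<longrightarrow> Suc a = m"
  have "x < a" if "x \<in> free m A" "(a, m) \<in> A" for x a
  proof -
    have "Suc a = m" "x \<noteq> a" "x \<noteq> m" "x \<le> m" using * that unfolding free_def by auto
    then show ?thesis by simp
  qed
  then have "avail m A = free m A" unfolding avail_def by blast
  then show "card (avail m A) = card (free m A)" by simp
qed

text \<open>
  Adding an arc that starts at the available point of rank \<open>e\<close> is a bijection onto the systems with
  exactly \<open>e\<close> available points.
\<close>

lemma card_admissible_sets_step:
  assumes "e < i"
  shows "card (admissible_sets i (Suc k) e) = card (admissible_sets i (Suc k) (Suc e)) + card (admissible_sets i k (Suc e))"
proof -
  define m where "m = i + 2 * k"
  have m2: "i + 2 * Suc k = Suc (Suc m)" by (simp add: m_def)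
  define X where "X = {A. admissible (Suc (Suc m)) A \<and> card A = Suc k \<and> card (avail (Suc (Suc m)) A) = e}"
  define f where "f A = A - {p. snd p = Suc (Suc m)}" for A :: "(nat \<times> nat) set"
  have fins: "f (insert (a, Suc (Suc m)) A) = A" if "admissible m A" for a A
    using arc_systemD(3)[OF admissibleD(1)[OF that]] unfolding f_def by force
  have rank: "bij_betw (\<lambda>a. card {x \<in> avail m A. x < a}) (avail m A) {..<card (avail m A)}" for A
    by (rule bij_betw_rank) simp
  have XD: "\<exists>a. a \<in> avail m (f A) \<and> A = insert (a, Suc (Suc m)) (f A) \<and> admissible m (f A) \<and> card (f A) = k
              \<and> card {x \<in> avail m (f A). x < a} = e" if "A \<in> X" for A
  proof -
    from that have g: "admissible (Suc (Suc m)) A" and c: "card A = Suc k"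
      and ca: "card (avail (Suc (Suc m)) A) = e" unfolding X_def by auto
    have "card (free (Suc (Suc m)) A) = i"
      using card_free_admissible[of i "Suc k" A] g c m2 by simp
    then obtain a where a: "(a, Suc (Suc m)) \<in> A" "Suc a \<noteq> Suc (Suc m)"
      using avail_eq_free_iff[OF g] ca assms by auto
    define B where "B = A - {(a, Suc (Suc m))}"
    have AB: "A = insert (a, Suc (Suc m)) B" using a B_def by blast
    have B: "admissible m B" "a \<in> avail m B"
      using admissible_last_arc[OF g a(1)] a(2) unfolding B_def by force+
    have "f A = B" using fins[OF B(1)] AB by simp
    moreover have "card B = k" using a c B_def by simp
    moreover have "card {x \<in> avail m B. x < a} = e"
      using avail_insert[OF B] ca AB by simp
    ultimately show ?thesis using B AB by blast
  qed
  have "bij_betw f X (admissible_sets i k (Suc e))"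
    unfolding bij_betw_def
  proof
    show "inj_on f X"
    proof (rule inj_onI)
      fix A B assume "A \<in> X" "B \<in> X" and eq: "f A = f B"
      from XD[OF this(1)] XD[OF this(2)] obtain a b where
        "a \<in> avail m (f A)" "A = insert (a, Suc (Suc m)) (f A)" "card {x \<in> avail m (f A). x < a} = e"
        "b \<in> avail m (f A)" "B = insert (b, Suc (Suc m)) (f A)" "card {x \<in> avail m (f A). x < b} = e"
        unfolding eq by blast
      moreover from this have "a = b"
        using rank[of "f A"] by (auto simp: bij_betw_def dest: inj_onD)
      ultimately show "A = B" by simp
    qed
    show "f ` X = admissible_sets i k (Suc e)"
    proof (intro equalityI subsetI)
      fix B assume "B \<in> f ` X"
      then obtain A where "A \<in> X" "B = f A" by blast
      with XD[OF this(1)] obtain a where a: "a \<in> avail m B" "admissible m B" "card B = k"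
        "card {x \<in> avail m B. x < a} = e" by auto
      have "e < card (avail m B)"
        using bij_betwE[OF rank[of B]] a by blast
      then show "B \<in> admissible_sets i k (Suc e)" using a unfolding admissible_sets_def m_def by simp
    next
      fix B assume "B \<in> admissible_sets i k (Suc e)"
      then have B: "admissible m B" "card B = k" "e < card (avail m B)"
        unfolding admissible_sets_def m_def by auto
      then obtain a where a: "a \<in> avail m B" "card {x \<in> avail m B. x < a} = e"
        using rank[of B] unfolding bij_betw_def by (metis (mono_tags, lifting) imageE lessThan_iff)
      let ?A = "insert (a, Suc (Suc m)) B"
      have "a \<le> m" using a unfolding avail_def free_def by simp
      then have "admissible (Suc (Suc m)) ?A" "(a, Suc (Suc m)) \<notin> B"
        using admissible_insert_iff[of a m B] a B by auto
      moreover have "finite B" using arc_system_finite admissibleD(1) B(1) by blast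
      ultimately have "?A \<in> X"
        using avail_insert[OF B(1) a(1)] a B unfolding X_def by simp
      then show "B \<in> f ` X" using fins[OF B(1), of a] by force
    qed
  qed
  then have "card X = card (admissible_sets i k (Suc e))" by (rule bij_betw_same_card)
  moreover have "admissible_sets i (Suc k) e = admissible_sets i (Suc k) (Suc e) \<union> X"
    "admissible_sets i (Suc k) (Suc e) \<inter> X = {}"
    unfolding admissible_sets_def X_def m2 by auto
  moreover have "finite X" unfolding X_def by (rule finite_admissible)
  ultimately show ?thesis by (simp add: card_Un_disjoint)
qed

lemma admissible_sets_0: "admissible_sets i 0 e = (if e \<le> i then {{}} else {})"
proof -
  have "A = {}" if "admissible i A" "card A = 0" for A
    using arc_system_finite[OF admissibleD(1)[OF that(1)]] that(2) by simp
  moreover have "admissible i {}" unfolding admissible_def arc_system_def by simp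
  ultimately have "admissible_sets i 0 e = {A. A = {} \<and> e \<le> card (avail i {})}"
    unfolding admissible_sets_def by auto
  moreover have "avail i {} = {1..i}" unfolding avail_def free_def by auto
  ultimately show ?thesis by simp
qed

lemma admissible_sets_top:
  "admissible_sets i k i =
     {A. admissible (i + 2 * k) A \<and> card A = k \<and> (\<forall>a. (a, i + 2 * k) \<in> A \<longrightarrow> Suc a = i + 2 * k)}"
proof -
  have "i \<le> card (avail (i + 2 * k) A) \<longleftrightarrow> (\<forall>a. (a, i + 2 * k) \<in> A \<longrightarrow> Suc a = i + 2 * k)"
    if "admissible (i + 2 * k) A" "card A = k" for A
    using avail_eq_free_iff[OF that(1)] card_free_admissible[OF that]
      card_mono[OF finite_free avail_subset_free, of "i + 2 * k" A] by auto
  then show ?thesis unfolding admissible_sets_def by blast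
qed

text \<open>When all unmatched points are available, the last point is either unmatched
  (\<open>Y\<close>), and dropping it leaves \<open>i - 1\<close> of them, or it ends a short arc
  (\<open>Z\<close>), whose deletion keeps \<open>i\<close>.\<close>

lemma card_admissible_sets_top:
  "card (admissible_sets i (Suc k) i) =
     (if i = 0 then 0 else card (admissible_sets (i - 1) (Suc k) 0)) + card (admissible_sets i k 0)"
proof -
  define m where "m = i + 2 * k"
  have m2: "i + 2 * Suc k = Suc (Suc m)" by (simp add: m_def)
  define Y where "Y = {A. admissible (Suc m) A \<and> card A = Suc k}"
  define Z where "Z = {A. admissible (Suc (Suc m)) A \<and> card A = Suc k \<and> (Suc m, Suc (Suc m)) \<in> A}"
  have "admissible_sets i (Suc k) i = Y \<union> Z"
  proof -
    have "A \<in> admissible_sets i (Suc k) i \<longleftrightarrow> A \<in> Y \<union> Z" for A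
      unfolding admissible_sets_top m2 Y_def Z_def using admissible_Suc_iff[of "Suc m" A] by auto
         (metis admissibleD(1) arc_system_unique(1))
    then show ?thesis by blast
  qed
  moreover have "Y \<inter> Z = {}" unfolding Y_def Z_def using admissible_Suc_iff[of "Suc m"] by auto
  moreover have "finite Y" "finite Z" unfolding Y_def Z_def by (rule finite_admissible)+
  ultimately have "card (admissible_sets i (Suc k) i) = card Y + card Z"
    by (simp add: card_Un_disjoint)
  moreover have "card Y = (if i = 0 then 0 else card (admissible_sets (i - 1) (Suc k) 0))"
  proof (cases i)
    case 0
    \<comment> \<open>The \<open>k + 1\<close> arcs would need more than the
      \<open>2 * k + 1\<close> points at hand.\<close>
    have "A \<notin> Y" for A
      using card_free[OF admissibleD(1), of "Suc m" A] unfolding Y_def m_def 0 by auto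
    then have "Y = {}" by blast
    then show ?thesis using 0 by simp
  next
    case (Suc i')
    then show ?thesis unfolding admissible_sets_def Y_def m_def by simp
  qed
  moreover have "card Z = card (admissible_sets i k 0)"
  proof (rule bij_betw_same_card)
    let ?p = "(Suc m, Suc (Suc m))"
    have nin: "?p \<notin> A" "finite A" if "admissible m A" for A
      using arc_system_finite[OF admissibleD(1)[OF that]] arc_systemD[OF admissibleD(1)[OF that]] by force+
    show "bij_betw (\<lambda>A. A - {?p}) Z (admissible_sets i k 0)"
    proof (rule bij_betw_byWitness[where f' = "insert ?p"])
      show "\<forall>A\<in>Z. insert ?p (A - {?p}) = A" unfolding Z_def by auto
      show "\<forall>A\<in>admissible_sets i k 0. insert ?p A - {?p} = A"
        unfolding admissible_sets_def m_def[symmetric] using nin by auto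
      show "(\<lambda>A. A - {?p}) ` Z \<subseteq> admissible_sets i k 0"
      proof
        fix B assume "B \<in> (\<lambda>A. A - {?p}) ` Z"
        then obtain A where A: "admissible (Suc (Suc m)) A" "card A = Suc k" "?p \<in> A" "B = A - {?p}"
          unfolding Z_def by auto
        then show "B \<in> admissible_sets i k 0"
          using admissible_short_iff[of m B] unfolding admissible_sets_def m_def[symmetric]
          by (auto simp: insert_absorb)
      qed
      show "insert ?p ` admissible_sets i k 0 \<subseteq> Z"
        unfolding admissible_sets_def Z_def m_def[symmetric] using nin admissible_short_iff[of m] by auto
    qed
  qed
  ultimately show ?thesis by simp
qed

section \<open>Generating functions and their recurrence\<close>

text \<open>The arc marker is \<open>u = xy\<close>: the coefficient of \<open>x\<^sup>k\<close> carries the factor \<open>y\<^sup>k\<close>.\<close>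

definition family_gf :: "nat \<Rightarrow> nat \<Rightarrow> rat fps fps" where
  "family_gf i e = Abs_fps (\<lambda>k. of_nat (card (admissible_sets i k e)) * fps_X ^ k)"

lemma nth_family_gf: "fps_nth (family_gf i e) k = of_nat (card (admissible_sets i k e)) * fps_X ^ k"
  by (simp add: family_gf_def)

lemma nth_xy_mult:
  "fps_nth (var_x * var_y * f) k = (if k = 0 then 0 else fps_X * fps_nth f (k - 1))"
  by (simp add: mult.assoc)

text \<open>The summand 1 keeps the systems with more than \<open>e\<close> available points;
  \<open>xy\<close> marks the arc deleted from those with exactly \<open>e\<close>.\<close>

lemma family_gf_step:
  assumes "e < i"
  shows "family_gf i e = (1 + var_x * var_y) * family_gf i (Suc e)"
proof (rule fps_ext)
  fix k
  show "fps_nth (family_gf i e) k = fps_nth ((1 + var_x * var_y) * family_gf i (Suc e)) k"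
    using assms card_admissible_sets_step[OF assms]
    by (cases k) (simp_all add: distrib_right nth_xy_mult nth_family_gf admissible_sets_0 algebra_simps del: mult.assoc)
qed

lemma family_gf_power: "e \<le> i \<Longrightarrow> family_gf i (i - e) = (1 + var_x * var_y) ^ e * family_gf i i"
proof (induction e)
  case (Suc e)
  then show ?case using family_gf_step[of "i - Suc e" i] by (simp add: Suc_diff_Suc mult.assoc)
qed simp

text \<open>For \<open>i = 0\<close> the 1 is the empty system, which
  \<open>card_admissible_sets_top\<close>, being about at least one arc, leaves out.\<close>

lemma family_gf_top:
  "family_gf i i = (if i = 0 then 1 else family_gf (i - 1) 0) + var_x * var_y * family_gf i 0"
proof (rule fps_ext)
  fix k
  show "fps_nth (family_gf i i) k =
    fps_nth ((if i = 0 then 1 else family_gf (i - 1) 0) + var_x * var_y * family_gf i 0) k"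
    using card_admissible_sets_top[of i]
    by (cases k) (simp_all add: nth_xy_mult nth_family_gf admissible_sets_0 algebra_simps del: mult.assoc)
qed

text \<open>Passing from \<open>e = i\<close> to \<open>e = 0\<close> costs \<open>i\<close> factors
  \<open>1 + xy\<close>; it remains to collect \<open>family_gf i 0\<close> on one side.\<close>

lemma family_gf_rec:
  "family_gf i 0 * (1 - (1 + var_x * var_y) ^ i * (var_x * var_y)) =
     (1 + var_x * var_y) ^ i * (if i = 0 then 1 else family_gf (i - 1) 0)"
  using family_gf_power[of i i] unfolding family_gf_top[of i] by (simp add: algebra_simps)

text \<open>The recurrence is iterated down to 0; the exponents \<open>0 + 1 + ... + i\<close> add
  up to the binomial coefficient.\<close>

lemma family_gf_mult_denominator:
  "family_gf i 0 * (\<Prod>k=0..i. 1 - (1 + var_x * var_y) ^ k * (var_x * var_y)) =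
     (1 + var_x * var_y) ^ (Suc i choose 2)"
proof (induction i)
  case 0
  then show ?case using family_gf_rec[of 0] by (simp add: numeral_2_eq_2)
next
  case (Suc i)
  let ?q = "1 + var_x * var_y" and ?d = "\<lambda>k. 1 - (1 + var_x * var_y) ^ k * (var_x * var_y)"
  have "family_gf (Suc i) 0 * prod ?d {0..Suc i} = family_gf (Suc i) 0 * ?d (Suc i) * prod ?d {0..i}"
    by (simp add: mult_ac)
  also have "\<dots> = ?q ^ Suc i * (family_gf i 0 * prod ?d {0..i})"
    using family_gf_rec[of "Suc i"] by (simp add: mult_ac)
  also have "\<dots> = ?q ^ (Suc i + (Suc i choose 2))"
    unfolding Suc by (simp only: power_add)
  also have "Suc i + (Suc i choose 2) = (Suc (Suc i) choose 2)"
    by (simp add: numeral_2_eq_2)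
  finally show ?case .
qed

text \<open>Both sides agree after multiplication by the denominator, which is nonzero and so can be
  cancelled.\<close>

lemma rhs_term_eq: "rhs_term (Suc i) = var_x ^ Suc i * family_gf i 0"
proof -
  let ?d = "\<Prod>k=0..i. 1 - (1 + var_x * var_y) ^ k * (var_x * var_y)"
  have "?d \<noteq> 0" using rhs_denominator_nth_0[of "Suc i"] by force
  moreover have "rhs_term (Suc i) * ?d = var_x ^ Suc i * family_gf i 0 * ?d"
    using rhs_term_mult_denominator[of "Suc i"] family_gf_mult_denominator[of i]
    by (simp add: mult.assoc)
  ultimately show ?thesis by (metis mult_right_cancel)
qed

section \<open>Partial matchings and arc systems\<close>

lemma arc_system_arcs:
  assumes "partial_matching m M"
  shows "arc_system m (arcs M)"
proof -
  have p: "partition_on {1..m} M" using assms unfolding partial_matching_def by simp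
  have sub: "B \<subseteq> {1..m}" if "B \<in> M" for B using p that unfolding partition_on_def by blast
  have "B = C" if "B \<in> M" "C \<in> M" "x \<in> B" "x \<in> C" for B C x
    using partition_onD2[OF p] that unfolding disjoint_def by blast
  then have eq: "{i, j} = {i', j'}"
    if "{i, j} \<in> M" "{i', j'} \<in> M" "i = i' \<or> i = j' \<or> j = i' \<or> j = j'" for i j i' j'
    using that by blast
  have "i = i' \<and> j = j'" if "(i, j) \<in> arcs M" "(i', j') \<in> arcs M"
    "i = i' \<or> i = j' \<or> j = i' \<or> j = j'" for i j i' j'
    using eq[of i j i' j'] that unfolding arcs_def by (auto simp: doubleton_eq_iff)
  moreover have "1 \<le> i \<and> i < j \<and> j \<le> m" if "(i, j) \<in> arcs M" for i j
    using that sub[of "{i, j}"] unfolding arcs_def by auto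
  ultimately show ?thesis unfolding arc_system_def by blast
qed

lemma admissible_arcs_iff:
  assumes "partial_matching m M"
  shows "admissible m (arcs M) \<longleftrightarrow> \<not> has_2_right_crossing M \<and> \<not> has_right_nesting M"
proof
  assume g: "admissible m (arcs M)"
  show "\<not> has_2_right_crossing M \<and> \<not> has_right_nesting M"
  proof
    show "\<not> has_2_right_crossing M"
    proof
      assume "has_2_right_crossing M"
      then obtain i1 j1 i2 j2 where h: "(i1, j1) \<in> arcs M" "(i2, j2) \<in> arcs M"
        "i1 < i2" "i2 < j1" "j1 < j2" "j2 - j1 \<le> 2"
        unfolding has_2_right_crossing_def by blast
      then consider "j2 = Suc j1" | "j2 = Suc (Suc j1)" by linarith
      then show False
        by cases (use admissibleD(2,3)[OF g] h in force)+
    qed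
    show "\<not> has_right_nesting M"
      using admissibleD(2)[OF g] unfolding has_right_nesting_def by auto
  qed
next
  note s = arc_system_arcs[OF assms]
  note D = arc_systemD[OF s] and U = arc_system_unique[OF s]
  assume n: "\<not> has_2_right_crossing M \<and> \<not> has_right_nesting M"
  have cross: "\<not> (i1 < i2 \<and> i2 < j1 \<and> j1 < j2 \<and> j2 - j1 \<le> 2)"
    if "(i1, j1) \<in> arcs M" "(i2, j2) \<in> arcs M" for i1 j1 i2 j2
    using n that unfolding has_2_right_crossing_def by blast
  have nest: "\<not> (i1 < i2 \<and> i2 < j2 \<and> j1 = j2 + 1)"
    if "(i1, j1) \<in> arcs M" "(i2, j2) \<in> arcs M" for i1 j1 i2 j2
    using n that unfolding has_right_nesting_def by auto
  have "(i', Suc j) \<notin> arcs M" if a: "(i, j) \<in> arcs M" for i j i'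
  proof
    assume b: "(i', Suc j) \<in> arcs M"
    have "i' \<noteq> j" "i' \<noteq> i" using U[OF a b] D[OF a] by auto
    \<comment> \<open>Now \<open>i' < j\<close>: the arcs cross if \<open>i < i'\<close> and nest if
      \<open>i' < i\<close>.\<close>
    then show False using cross[OF a b] nest[OF b a] D[OF a] D[OF b] by auto
  qed
  moreover have "i' < i \<or> i' = Suc j"
    if a: "(i, j) \<in> arcs M" and b: "(i', Suc (Suc j)) \<in> arcs M" for i j i'
  proof -
    have "i' \<noteq> j" "i' \<noteq> i" using U[OF a b] D[OF a] by auto
    \<comment> \<open>If \<open>i < i'\<close>, then \<open>i' < j\<close> would be a crossing at
      distance 2, so only \<open>i' = j + 1\<close> is left.\<close>
    then show ?thesis using cross[OF a b] D[OF a] D[OF b] by auto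
  qed
  ultimately show "admissible m (arcs M)" using s unfolding admissible_def by blast
qed

text \<open>The inverse of \<open>arcs\<close>; the parameter \<open>m\<close> serves to restore the
  singletons.\<close>

definition matching_of :: "nat \<Rightarrow> (nat \<times> nat) set \<Rightarrow> nat set set" where
  "matching_of m A = (\<lambda>(i, j). {i, j}) ` A \<union> (\<lambda>a. {a}) ` free m A"

lemma partial_matching_matching_of:
  assumes "arc_system m A"
  shows "partial_matching m (matching_of m A)"
proof -
  note D = arc_systemD[OF assms] and U = arc_system_unique[OF assms]
  have block: "(\<exists>i j. B = {i, j} \<and> (i, j) \<in> A \<and> (x = i \<or> x = j)) \<or> B = {x} \<and> x \<in> free m A"
    if "B \<in> matching_of m A" "x \<in> B" for B x
    using that unfolding matching_of_def by auto
  have not_free: "x \<notin> free m A" if "(i, j) \<in> A" "x = i \<or> x = j" for x i j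
    using that unfolding free_def by auto
  have "B = C" if "B \<in> matching_of m A" "C \<in> matching_of m A" "x \<in> B" "x \<in> C" for B C x
  proof (cases "x \<in> free m A")
    note xB = block[OF that(1,3)] and xC = block[OF that(2,4)]
    case True
    then show ?thesis using xB xC not_free by blast
  next
    note xB = block[OF that(1,3)] and xC = block[OF that(2,4)]
    case False
    then obtain i j i' j' where ij: "B = {i, j}" "(i, j) \<in> A" "x = i \<or> x = j"
      and ij': "C = {i', j'}" "(i', j') \<in> A" "x = i' \<or> x = j'"
      using xB xC by blast
    then have "i = i' \<or> i = j' \<or> j = i' \<or> j = j'" by metis
    from U[OF ij(2) ij'(2) this] show ?thesis unfolding ij(1) ij'(1) by (rule arg_cong2)
  qed
  then have "disjoint (matching_of m A)" unfolding disjoint_def by blast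
  moreover have "\<Union> (matching_of m A) = {1..m}"
  proof (intro equalityI subsetI)
    fix x assume x: "x \<in> {1..m}"
    show "x \<in> \<Union> (matching_of m A)"
    proof (cases "x \<in> free m A")
      case True
      then show ?thesis unfolding matching_of_def by blast
    next
      case False
      then obtain b where "(x, b) \<in> A \<or> (b, x) \<in> A" using x unfolding free_def by blast
      then show ?thesis unfolding matching_of_def by blast
    qed
  next
    fix x assume "x \<in> \<Union> (matching_of m A)"
    then obtain B where "B \<in> matching_of m A" "x \<in> B" by blast
    from block[OF this] show "x \<in> {1..m}"
    proof (elim disjE exE conjE)
      fix i j assume "(i, j) \<in> A" "x = i"
      then show ?thesis using D[of i j] by simp
    next
      fix i j assume "(i, j) \<in> A" "x = j"
      then show ?thesis using D[of i j] by simp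
    qed (simp add: free_def)
  qed
  moreover have "{} \<notin> matching_of m A" unfolding matching_of_def by auto
  moreover have "card B \<le> 2" if "B \<in> matching_of m A" for B
    using that unfolding matching_of_def by (auto simp: card_insert_if)
  ultimately show ?thesis unfolding partial_matching_def partition_on_def by blast
qed

lemma arcs_matching_of:
  assumes "arc_system m A"
  shows "arcs (matching_of m A) = A"
  using arc_systemD[OF assms] unfolding arcs_def matching_of_def
  by (force simp: doubleton_eq_iff image_iff)

lemma matching_of_arcs:
  assumes "partial_matching m M"
  shows "matching_of m (arcs M) = M"
proof -
  have p: "partition_on {1..m} M" and c: "\<And>B. B \<in> M \<Longrightarrow> card B \<le> 2"
    using assms unfolding partial_matching_def by auto
  have p': "partition_on {1..m} (matching_of m (arcs M))"
    using partial_matching_matching_of[OF arc_system_arcs[OF assms]]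
    unfolding partial_matching_def by simp
  have uniq: "B = C" if "B \<in> M" "C \<in> M" "x \<in> B" "x \<in> C" for B C x
    using partition_onD2[OF p] that unfolding disjoint_def by blast
  have "M \<subseteq> matching_of m (arcs M)"
  proof
    fix B assume B: "B \<in> M"
    then have sub: "B \<subseteq> {1..m}" and ne: "B \<noteq> {}" using p unfolding partition_on_def by blast+
    then have "finite B" using finite_subset by blast
    then have "card B \<noteq> 0" using ne by simp
    then consider "card B = 1" | "card B = 2" using c[OF B] by linarith
    then show "B \<in> matching_of m (arcs M)"
    proof cases
      case 1
      then obtain x where x: "B = {x}" by (auto simp: card_1_singleton_iff)
      have "{x, b} \<notin> M" if "x \<noteq> b" for b
        using uniq[of B "{x, b}" x] B x that by auto
      then have "(x, b) \<notin> arcs M" "(b, x) \<notin> arcs M" for b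
        unfolding arcs_def by (auto simp: insert_commute)
      then show ?thesis using x sub unfolding matching_of_def free_def by auto
    next
      case 2
      then obtain x y where xy: "B = {x, y}" "x < y"
        by (metis card_2_iff insert_commute linorder_neqE_nat)
      then have "(x, y) \<in> arcs M" using B unfolding arcs_def by simp
      then show ?thesis using xy unfolding matching_of_def by force
    qed
  qed
  \<comment> \<open>Two partitions of one set, one contained in the other, are equal: each block of
    the larger meets, hence is, a block of the smaller.\<close>
  moreover have "matching_of m (arcs M) \<subseteq> M"
  proof
    fix C assume C: "C \<in> matching_of m (arcs M)"
    moreover have "\<Union> (matching_of m (arcs M)) = {1..m}" "C \<noteq> {}"
      using p' C unfolding partition_on_def by auto
    ultimately obtain x where x: "x \<in> C" "x \<in> {1..m}" by blast
    then obtain B where B: "B \<in> M" "x \<in> B" using p unfolding partition_on_def by blast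
    then have "B = C"
      using partition_onD2[OF p'] C x \<open>M \<subseteq> matching_of m (arcs M)\<close> unfolding disjoint_def by blast
    then show "C \<in> M" using B by simp
  qed
  ultimately show ?thesis by blast
qed

lemma matching_count_eq: "matching_count (i + 2 * k) k = card (admissible_sets i k 0)"
  unfolding matching_count_def
proof (rule bij_betw_same_card, rule bij_betw_byWitness[where f = arcs and f' = "matching_of (i + 2 * k)"])
  let ?m = "i + 2 * k"
  let ?S = "{M. partial_matching ?m M \<and> card (arcs M) = k \<and>
                    \<not> has_2_right_crossing M \<and> \<not> has_right_nesting M}"
  show "\<forall>M\<in>?S. matching_of ?m (arcs M) = M" using matching_of_arcs by blast
  show "\<forall>A\<in>admissible_sets i k 0. arcs (matching_of ?m A) = A"
    unfolding admissible_sets_def using arcs_matching_of admissibleD(1) by blast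
  show "arcs ` ?S \<subseteq> admissible_sets i k 0"
    unfolding admissible_sets_def using admissible_arcs_iff by auto
  show "matching_of ?m ` admissible_sets i k 0 \<subseteq> ?S"
  proof
    fix M assume "M \<in> matching_of ?m ` admissible_sets i k 0"
    then obtain A where A: "admissible ?m A" "card A = k" "M = matching_of ?m A"
      unfolding admissible_sets_def by auto
    then show "M \<in> ?S"
      using partial_matching_matching_of[of ?m A] arcs_matching_of[of ?m A] admissibleD(1)[of ?m A]
        admissible_arcs_iff[of ?m M] by auto
  qed
qed

section \<open>Comparison of the two series\<close>

text \<open>Term \<open>n + 1\<close> concerns \<open>n + k\<close> points and \<open>k\<close>
  arcs, hence \<open>n - k\<close> unmatched points. Its sum over \<open>k\<close> involves only
  \<open>y\<close>, so it is a constant in \<open>x\<close>.\<close>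

lemma lhs_term_eq:
  "lhs_term (Suc n) =
     var_x ^ Suc n * fps_const (\<Sum>k\<le>n. of_nat (card (admissible_sets (n - k) k 0)) * fps_X ^ k)"
proof -
  have "lhs_term (Suc n) = (\<Sum>k\<le>n. var_x ^ Suc n * (of_nat (card (admissible_sets (n - k) k 0)) * var_y ^ k))"
    unfolding lhs_term_def
  proof (rule sum.cong)
    fix k assume "k \<in> {..n}"
    then have "Suc n + k - 1 = (n - k) + 2 * k" by simp
    then have "matching_count (Suc n + k - 1) k = card (admissible_sets (n - k) k 0)"
      by (simp only: matching_count_eq)
    then show "of_nat (matching_count (Suc n + k - 1) k) * var_x ^ Suc n * var_y ^ k
      = var_x ^ Suc n * (of_nat (card (admissible_sets (n - k) k 0)) * var_y ^ k)"
      by (simp only: mult_ac)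
  qed auto
  also have "\<dots> = var_x ^ Suc n * (\<Sum>k\<le>n. fps_const (of_nat (card (admissible_sets (n - k) k 0)) * fps_X ^ k))"
    by (simp only: sum_distrib_left[symmetric] fps_of_nat[symmetric] fps_const_power fps_const_mult)
  also have "(\<Sum>k\<le>n. fps_const (of_nat (card (admissible_sets (n - k) k 0)) * fps_X ^ k)) =
      fps_const (\<Sum>k\<le>n. of_nat (card (admissible_sets (n - k) k 0)) * (fps_X :: rat fps) ^ k)"
    by (rule fps_ext) (simp add: fps_sum_nth)
  finally show ?thesis .
qed

text \<open>Term \<open>n\<close> affects only coefficients of index at least \<open>n\<close>, so
  each coefficient of the partial sums is eventually constant.\<close>

lemma sums_fps_X_power_mult:
  fixes g :: "nat \<Rightarrow> 'a :: comm_ring_1 fps"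
  shows "(\<lambda>n. fps_X ^ n * g n) sums Abs_fps (\<lambda>N. \<Sum>n\<le>N. fps_nth (g n) (N - n))"
  unfolding sums_def tendsto_fps_iff
proof
  fix N
  have "fps_nth (\<Sum>n<K. fps_X ^ n * g n) N = (\<Sum>n\<le>N. fps_nth (g n) (N - n))" if "K > N" for K
  proof -
    have "fps_nth (\<Sum>n<K. fps_X ^ n * g n) N = (\<Sum>n<K. if n \<le> N then fps_nth (g n) (N - n) else 0)"
      by (auto simp: fps_sum_nth fps_X_power_mult_nth intro!: sum.cong)
    also have "\<dots> = (\<Sum>n\<le>N. fps_nth (g n) (N - n))"
      by (rule sum.mono_neutral_cong_right) (use that in auto)
    finally show ?thesis .
  qed
  then show "\<forall>\<^sub>F K in sequentially. fps_nth (\<Sum>n<K. fps_X ^ n * g n) N =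
      fps_nth (Abs_fps (\<lambda>N. \<Sum>n\<le>N. fps_nth (g n) (N - n))) N"
    using eventually_mono[OF eventually_gt_at_top[of N]] by simp
qed

text \<open>Both series enumerate systems with \<open>n\<close> unmatched points and
  \<open>k\<close> arcs: the left groups them by \<open>n + k\<close>, the right by
  \<open>n\<close>.\<close>

theorem theorem1p1:
  shows "summable (\<lambda>n. lhs_term (Suc n)) \<and> summable (\<lambda>n. rhs_term (Suc n)) \<and>
         (\<Sum>n. lhs_term (Suc n)) = (\<Sum>n. rhs_term (Suc n))"
proof -
  let ?c = "\<lambda>n. \<Sum>k\<le>n. of_nat (card (admissible_sets (n - k) k 0)) * (fps_X :: rat fps) ^ k"
  \<comment> \<open>One factor \<open>x\<close> stays in the cofactor, so that the exponent split
    off equals the summation index.\<close>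
  have l: "lhs_term (Suc n) = fps_X ^ n * (fps_X * fps_const (?c n))" for n
    by (simp only: lhs_term_eq power_Suc mult_ac)
  have r: "rhs_term (Suc n) = fps_X ^ n * (fps_X * family_gf n 0)" for n
    by (simp only: rhs_term_eq power_Suc mult_ac)
  note sums_l = sums_fps_X_power_mult[of "\<lambda>n. fps_X * fps_const (?c n)", folded l]
  note sums_r = sums_fps_X_power_mult[of "\<lambda>n. fps_X * family_gf n 0", folded r]
  have "(\<Sum>n\<le>N. fps_nth (fps_X * fps_const (?c n)) (N - n)) =
        (\<Sum>n\<le>N. fps_nth (fps_X * family_gf n 0) (N - n))" for N
  proof (cases N)
    case (Suc M)
    \<comment> \<open>The cofactor is \<open>x\<close> times a constant, so only
      \<open>n = M\<close> contributes.\<close>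
    have "(\<Sum>n\<le>N. fps_nth (fps_X * fps_const (?c n)) (N - n)) =
          (\<Sum>n\<le>N. if n = M then ?c n else 0)"
    proof (rule sum.cong)
      fix n assume "n \<in> {..N}"
      then have "N - n - 1 = 0 \<and> N - n \<noteq> 0 \<longleftrightarrow> n = M" using Suc by auto
      then show "fps_nth (fps_X * fps_const (?c n)) (N - n) = (if n = M then ?c n else 0)"
        by auto
    qed simp
    also have "\<dots> = ?c M" using Suc by simp
    also have "\<dots> = (\<Sum>n\<le>M. of_nat (card (admissible_sets n (M - n) 0)) * fps_X ^ (M - n))"
      by (rule sum.reindex_bij_witness[where i = "\<lambda>n. M - n" and j = "\<lambda>n. M - n"]) auto
    \<comment> \<open>The extra summand \<open>n = N\<close> is the constant coefficient of a
      multiple of \<open>x\<close>, hence 0.\<close>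
    also have "\<dots> = (\<Sum>n\<le>N. fps_nth (fps_X * family_gf n 0) (N - n))"
      unfolding Suc by (simp add: Suc_diff_le nth_family_gf)
    finally show ?thesis .
  qed simp
  then show ?thesis
    using sums_l sums_r by (auto simp: sums_iff)
qed

end
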